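(* Let $\mathcal M=(M,\rho)$ be a finite additive pseudo-metric space. Then the weight $\mathrm{mf}(\mathcal M)$ of a minimal filling of $\mathcal M$ is equal to the half-perimeter $p(\mathcal M)$ of the space $\mathcal M$.
   Context: In a pseudo-metric space the distance between distinct points may be $0$. A finite graph $G=(V,E)$ joins $M$ if it is connected and $M\subset V$. For a weight function $\omega:E\to[0,\infty)$, $d_\omega(u,v)$ is the least weight (sum of $\omega$ over edges) of a path in $G$ joining $u$ and $v$, and $\omega(G)=\sum_{e\in E}\omega(e)$. The weighted graph $(G,\omega)$ is a filling of $\mathcal M=(M,\rho)$ if $G$ joins $M$ and $\rho(p,q)\le d_\omega(p,q)$ for all $p,q\in M$. $\mathrm{mf}(\mathcal M)$ is the infimum of $\omega(G)$ over all fillings of $\mathcal M$ (over all $G$), and a minimal filling is a filling of weight $\mathrm{mf}(\mathcal M)$. $(M,\rho)$ is additive if there exists a tree $G$ joining $M$ and a weight function $\omega:E\to[0,\infty)$ such that $\rho$ coincides with the restriction of $d_\omega$ to $M$. A cyclic order on $M$ is a cyclic permutation $\sigma:M\to M$ (a single cycle through all of $M$). The half-perimeter of $\mathcal M$ is $p(\mathcal M)=\min_\sigma\frac12\sum_{x\in M}\rho(x,\sigma(x))$, the minimum over all cyclic orders $\sigma$ on $M$. *)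

theory Defs
  imports Complex_Main "HOL-Combinatorics.Permutations" "HOL-Combinatorics.Orbits"
begin

definition pseudo_metric_on :: "'a set \<Rightarrow> ('a \<Rightarrow> 'a \<Rightarrow> real) \<Rightarrow> bool" where
  "pseudo_metric_on M \<rho> \<longleftrightarrow>
     (\<forall>x\<in>M. \<forall>y\<in>M. \<rho> x y \<ge> 0) \<and>
     (\<forall>x\<in>M. \<rho> x x = 0) \<and>
     (\<forall>x\<in>M. \<forall>y\<in>M. \<rho> x y = \<rho> y x) \<and>
     (\<forall>x\<in>M. \<forall>y\<in>M. \<forall>z\<in>M. \<rho> x z \<le> \<rho> x y + \<rho> y z)"

text \<open>Graphs are finite, undirected and simple; an edge is the set of its two end points.\<close>

definition finite_graph :: "'v set \<Rightarrow> 'v set set \<Rightarrow> bool" where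
  "finite_graph V E \<longleftrightarrow> finite V \<and> E \<subseteq> {{u, v} | u v. u \<in> V \<and> v \<in> V \<and> u \<noteq> v}"

definition is_path :: "'v set \<Rightarrow> 'v set set \<Rightarrow> 'v \<Rightarrow> 'v list \<Rightarrow> 'v \<Rightarrow> bool" where
  "is_path V E u p v \<longleftrightarrow>
     p \<noteq> [] \<and> hd p = u \<and> last p = v \<and> set p \<subseteq> V \<and> distinct p \<and>
     successively (\<lambda>x y. {x, y} \<in> E) p"

definition connected_graph :: "'v set \<Rightarrow> 'v set set \<Rightarrow> bool" where
  "connected_graph V E \<longleftrightarrow> V \<noteq> {} \<and> (\<forall>u\<in>V. \<forall>v\<in>V. \<exists>p. is_path V E u p v)"

definition is_cycle :: "'v set \<Rightarrow> 'v set set \<Rightarrow> 'v list \<Rightarrow> bool" where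
  "is_cycle V E p \<longleftrightarrow>
     length p \<ge> 3 \<and> set p \<subseteq> V \<and> distinct p \<and>
     successively (\<lambda>x y. {x, y} \<in> E) p \<and> {last p, hd p} \<in> E"

definition is_tree :: "'v set \<Rightarrow> 'v set set \<Rightarrow> bool" where
  "is_tree V E \<longleftrightarrow> finite_graph V E \<and> connected_graph V E \<and> (\<nexists>p. is_cycle V E p)"

definition joins :: "'v set \<Rightarrow> 'v set set \<Rightarrow> 'v set \<Rightarrow> bool" where
  "joins V E N \<longleftrightarrow> finite_graph V E \<and> connected_graph V E \<and> N \<subseteq> V"

definition weight_function :: "'v set set \<Rightarrow> ('v set \<Rightarrow> real) \<Rightarrow> bool" where
  "weight_function E \<omega> \<longleftrightarrow> (\<forall>e\<in>E. \<omega> e \<ge> 0)"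

definition path_weight :: "('v set \<Rightarrow> real) \<Rightarrow> 'v list \<Rightarrow> real" where
  "path_weight \<omega> p = (\<Sum>i<length p - 1. \<omega> {p ! i, p ! Suc i})"

text \<open>A path visits no vertex twice, so in a finite graph only finitely many paths compete
  and the minimum exists as soon as \<open>u\<close> and \<open>v\<close> are joined by some path.\<close>

definition graph_dist :: "'v set \<Rightarrow> 'v set set \<Rightarrow> ('v set \<Rightarrow> real) \<Rightarrow> 'v \<Rightarrow> 'v \<Rightarrow> real" where
  "graph_dist V E \<omega> u v = Min {path_weight \<omega> p | p. is_path V E u p v}"

definition graph_weight :: "'v set set \<Rightarrow> ('v set \<Rightarrow> real) \<Rightarrow> real" where
  "graph_weight E \<omega> = (\<Sum>e\<in>E. \<omega> e)"

text \<open>Graphs joining \<open>M\<close> may have arbitrary additional vertices, whereas the type \<open>'a\<close> may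
  contain no points outside \<open>M\<close>.  We therefore take vertices from \<open>'a + nat\<close> and
  identify \<open>x \<in> M\<close> with \<open>Inl x\<close>.  Since graphs are finite, every graph whose vertex set
  contains \<open>M\<close> is isomorphic, by an isomorphism fixing \<open>M\<close>, to one of this form.\<close>

definition filling ::
  "'a set \<Rightarrow> ('a \<Rightarrow> 'a \<Rightarrow> real) \<Rightarrow>
   ('a + nat) set \<Rightarrow> ('a + nat) set set \<Rightarrow> (('a + nat) set \<Rightarrow> real) \<Rightarrow> bool" where
  "filling M \<rho> V E \<omega> \<longleftrightarrow>
     joins V E (Inl ` M) \<and> weight_function E \<omega> \<and>
     (\<forall>p\<in>M. \<forall>q\<in>M. \<rho> p q \<le> graph_dist V E \<omega> (Inl p) (Inl q))"

definition mf :: "'a set \<Rightarrow> ('a \<Rightarrow> 'a \<Rightarrow> real) \<Rightarrow> real" where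
  "mf M \<rho> = Inf {graph_weight E \<omega> | V E \<omega>. filling M \<rho> V E \<omega>}"

definition additive_space :: "'a set \<Rightarrow> ('a \<Rightarrow> 'a \<Rightarrow> real) \<Rightarrow> bool" where
  "additive_space M \<rho> \<longleftrightarrow>
     (\<exists>(V :: ('a + nat) set) E \<omega>.
        is_tree V E \<and> joins V E (Inl ` M) \<and> weight_function E \<omega> \<and>
        (\<forall>p\<in>M. \<forall>q\<in>M. \<rho> p q = graph_dist V E \<omega> (Inl p) (Inl q)))"

text \<open>Requiring every orbit to be all of \<open>M\<close>, rather than \<open>cyclic_on \<sigma> M\<close>, differs only for
  empty \<open>M\<close>, where it admits the identity as the one (empty) cyclic order.\<close>

definition cyclic_order :: "'a set \<Rightarrow> ('a \<Rightarrow> 'a) \<Rightarrow> bool" where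
  "cyclic_order M \<sigma> \<longleftrightarrow> \<sigma> permutes M \<and> (\<forall>x\<in>M. orbit \<sigma> x = M)"

definition half_perimeter :: "'a set \<Rightarrow> ('a \<Rightarrow> 'a \<Rightarrow> real) \<Rightarrow> real" where
  "half_perimeter M \<rho> = Min {1/2 * (\<Sum>x\<in>M. \<rho> x (\<sigma> x)) | \<sigma>. cyclic_order M \<sigma>}"

end

theory Submission
  imports Defs
begin

text \<open>Both inequalities come from comparing cyclic orders with walks around a graph.

  \<^item> Let \<open>(V, E, \<omega>)\<close> be any filling. Growing a connected vertex set along edges yields a cyclic
    order on \<open>V\<close> of length at most twice the weight of the graph: inserting a new vertex \<open>b\<close> right
    after its neighbour \<open>a\<close> lengthens the tour by at most \<open>2 * \<omega> {a, b}\<close>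
    (\<open>connected_graph_tour\<close>). By the triangle inequality, deleting the vertices outside \<open>M\<close> does not
    lengthen it (\<open>cyclic_order_restrict\<close>), and \<open>\<rho>\<close> is dominated by the graph distance. Hence
    the filling weighs at least the half-perimeter (\<open>filling_tour\<close>). Additivity plays no role here.

  \<^item> Let a weighted tree realise \<open>\<rho>\<close>, and set the weight of all edges that lie on no path between
    points of \<open>M\<close> to \<open>0\<close>. The result is still a filling. Removing one of the other edges
    splits \<open>M\<close> into two nonempty parts (\<open>tree_edge_separates\<close>), so every cyclic order on \<open>M\<close>
    passes from each part to the other at least once, and the tree paths between successive points
    use the edge at least twice. Hence the weight of this filling is at most half the length of any
    cyclic order (\<open>additive_filling\<close>).\<close>

section \<open>Paths and the graph distance\<close>

text \<open>The set of edges that a path traverses.\<close>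

definition path_edges :: "'v list \<Rightarrow> 'v set set" where
  "path_edges p = (\<lambda>i. {p ! i, p ! Suc i}) ` {..<length p - 1}"

lemma path_weight_singleton [simp]: "path_weight \<omega> [x] = 0"
  by (simp add: path_weight_def)

lemma path_weight_Cons: "path_weight \<omega> (u # x # p) = \<omega> {u, x} + path_weight \<omega> (x # p)"
  unfolding path_weight_def by (simp add: sum.lessThan_Suc_shift del: sum.lessThan_Suc)

lemma path_weight_nonneg:
  assumes "weight_function E \<omega>" "successively (\<lambda>x y. {x, y} \<in> E) p"
  shows "0 \<le> path_weight \<omega> p"
  unfolding path_weight_def
  using assms by (intro sum_nonneg) (auto simp: weight_function_def successively_conv_nth)

lemma path_weight_suffix_le:
  assumes "weight_function E \<omega>" "successively (\<lambda>x y. {x, y} \<in> E) (p @ q)" "q \<noteq> []"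
  shows "path_weight \<omega> q \<le> path_weight \<omega> (p @ q)"
  using assms(2)
proof (induction p)
  case (Cons a p)
  obtain x r where xr: "p @ q = x # r"
    using assms(3) by (cases "p @ q") auto
  from Cons.prems have "{a, x} \<in> E" "successively (\<lambda>x y. {x, y} \<in> E) (p @ q)"
    by (auto simp: xr)
  with Cons.IH assms(1) show ?case
    by (auto simp: xr path_weight_Cons weight_function_def intro: add_increasing)
qed simp

lemma sum_path_edges_le:
  assumes "weight_function E \<omega>" "successively (\<lambda>x y. {x, y} \<in> E) p"
  shows "sum \<omega> (path_edges p) \<le> path_weight \<omega> p"
proof -
  have "sum \<omega> (path_edges p) \<le> sum (\<omega> \<circ> (\<lambda>i. {p ! i, p ! Suc i})) {..<length p - 1}"
    unfolding path_edges_def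
    using assms by (intro sum_image_le) (auto simp: weight_function_def successively_conv_nth)
  then show ?thesis by (simp add: path_weight_def)
qed

lemma path_edges_subset:
  assumes "successively (\<lambda>x y. {x, y} \<in> E) p"
  shows "path_edges p \<subseteq> E"
  using assms by (auto simp: path_edges_def successively_conv_nth)

lemma successively_path_edges: "successively (\<lambda>x y. {x, y} \<in> path_edges p) p"
  by (auto simp: path_edges_def successively_conv_nth)

lemma path_edges_split:
  assumes "e \<in> path_edges p"
  obtains xs a b ys where "p = xs @ a # b # ys" "e = {a, b}"
proof -
  obtain i where i: "i < length p - 1" "e = {p ! i, p ! Suc i}"
    using assms by (auto simp: path_edges_def)
  have "p = take i p @ p ! i # p ! Suc i # drop (Suc (Suc i)) p"
    using i(1) by (simp add: Cons_nth_drop_Suc)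
  with i(2) that show thesis by blast
qed

lemma successively_crossing:
  assumes "successively P p" "p \<noteq> []" "hd p \<in> S" "last p \<notin> S"
  obtains x y where "x \<in> S" "y \<notin> S" "P x y"
proof -
  have "\<exists>x y. x \<in> S \<and> y \<notin> S \<and> P x y"
    using assms
  proof (induction p)
    case (Cons a p)
    show ?case
    proof (cases "p = []")
      case False
      then show ?thesis
        using Cons by (cases "hd p \<in> S") (auto simp: successively_Cons)
    qed (use Cons.prems in auto)
  qed simp
  with that show thesis by blast
qed

lemma successively_rtrancl:
  assumes "successively P p" "p \<noteq> []"
  shows "(hd p, last p) \<in> {(x, y). P x y}\<^sup>*"
  using assms
proof (induction p)
  case (Cons a p)
  show ?case
  proof (cases "p = []")
    case False
    with Cons have "(a, hd p) \<in> {(x, y). P x y}" "(hd p, last p) \<in> {(x, y). P x y}\<^sup>*"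
      by (auto simp: successively_Cons)
    with False show ?thesis
      by (auto intro: converse_rtrancl_into_rtrancl)
  qed simp
qed simp

text \<open>Prolonging a path by an edge at its start. If the new vertex already lies on the path, the
  loop is cut off, which does not increase the weight.\<close>

lemma is_path_extend:
  assumes "weight_function E \<omega>" "is_path V E x p v" "{u, x} \<in> E" "u \<in> V"
  obtains q where "is_path V E u q v" "path_weight \<omega> q \<le> \<omega> {u, x} + path_weight \<omega> p"
proof (cases "u \<in> set p")
  case False
  obtain r where r: "p = x # r"
    using assms(2) by (cases p) (auto simp: is_path_def)
  have "is_path V E u (u # p) v"
    using assms False by (auto simp: is_path_def r)
  then show thesis
    using that[of "u # p"] by (simp add: r path_weight_Cons)
next
  case True
  then obtain r s where rs: "p = r @ u # s" by (meson split_list)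
  have succ: "successively (\<lambda>x y. {x, y} \<in> E) (r @ u # s)"
    using assms(2) by (simp add: is_path_def rs)
  have "is_path V E u (u # s) v"
    using assms(2) by (auto simp: is_path_def rs successively_append_iff)
  moreover have "path_weight \<omega> (u # s) \<le> \<omega> {u, x} + path_weight \<omega> p"
    using path_weight_suffix_le[OF assms(1) succ] assms(1,3)
    by (auto simp: rs weight_function_def intro: add_increasing)
  ultimately show thesis by (rule that)
qed

lemma rtrancl_imp_is_path:
  assumes "(u, v) \<in> {(x, y). {x, y} \<in> E}\<^sup>*" "v \<in> V" "\<And>x y. {x, y} \<in> E \<Longrightarrow> x \<in> V"
  shows "\<exists>p. is_path V E u p v"
  using assms(1)
proof (induction rule: converse_rtrancl_induct)
  case base
  have "is_path V E v [v] v" using assms(2) by (simp add: is_path_def)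
  then show ?case by blast
next
  case (step y z)
  have "weight_function E (\<lambda>_. 0)" by (simp add: weight_function_def)
  then show ?case
    using step assms(3) is_path_extend[of E "\<lambda>_. 0" V z _ v y] by blast
qed

lemma finite_paths:
  assumes "finite V"
  shows "finite {p. is_path V E u p v}"
  by (rule finite_subset[OF _ finite_subset_distinct[OF assms]]) (auto simp: is_path_def)

lemma graph_dist_le:
  assumes "finite V" "is_path V E u p v"
  shows "graph_dist V E \<omega> u v \<le> path_weight \<omega> p"
  unfolding graph_dist_def
  using finite_paths[OF assms(1), of E u v] assms(2) by (intro Min_le) auto

lemma graph_dist_attained:
  assumes "finite V" "connected_graph V E" "u \<in> V" "v \<in> V"
  obtains p where "is_path V E u p v" "graph_dist V E \<omega> u v = path_weight \<omega> p"
proof -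
  have "graph_dist V E \<omega> u v \<in> {path_weight \<omega> p | p. is_path V E u p v}"
    unfolding graph_dist_def
    using finite_paths[OF assms(1), of E u v] assms(2-4)
    by (intro Min_in) (auto simp: connected_graph_def)
  with that show thesis by blast
qed

lemma graph_dist_self_le:
  assumes "finite V" "u \<in> V"
  shows "graph_dist V E \<omega> u u \<le> 0"
  using graph_dist_le[OF assms(1), of E u "[u]" u \<omega>] assms(2) by (simp add: is_path_def)

lemma graph_dist_nonneg:
  assumes "finite V" "connected_graph V E" "weight_function E \<omega>" "u \<in> V" "v \<in> V"
  shows "0 \<le> graph_dist V E \<omega> u v"
proof -
  obtain p where "is_path V E u p v" "graph_dist V E \<omega> u v = path_weight \<omega> p"
    using graph_dist_attained[OF assms(1,2,4,5)] by blast
  then show ?thesis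
    using path_weight_nonneg[OF assms(3)] by (simp add: is_path_def)
qed

lemma graph_dist_edge_triangle:
  assumes "finite V" "connected_graph V E" "weight_function E \<omega>"
    and "{u, x} \<in> E" "u \<in> V" "x \<in> V" "v \<in> V"
  shows "graph_dist V E \<omega> u v \<le> \<omega> {u, x} + graph_dist V E \<omega> x v"
proof -
  obtain p where p: "is_path V E x p v" "graph_dist V E \<omega> x v = path_weight \<omega> p"
    using graph_dist_attained[OF assms(1,2,6,7)] by blast
  obtain q where "is_path V E u q v" "path_weight \<omega> q \<le> \<omega> {u, x} + path_weight \<omega> p"
    using is_path_extend[OF assms(3) p(1) assms(4,5)] .
  then show ?thesis
    using graph_dist_le[OF assms(1), of E u q v \<omega>] p(2) by linarith
qed

lemma graph_dist_triangle:
  assumes "finite V" "connected_graph V E" "weight_function E \<omega>"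
    and "u \<in> V" "v \<in> V" "w \<in> V"
  shows "graph_dist V E \<omega> u w \<le> graph_dist V E \<omega> u v + graph_dist V E \<omega> v w"
proof -
  have *: "graph_dist V E \<omega> (hd p) w \<le> path_weight \<omega> p + graph_dist V E \<omega> (last p) w"
    if "p \<noteq> []" "set p \<subseteq> V" "successively (\<lambda>x y. {x, y} \<in> E) p" for p
    using that
  proof (induction p rule: induct_list012)
    case (3 x y p)
    then show ?case
      using graph_dist_edge_triangle[OF assms(1-3), of x y w] assms(6)
      by (auto simp: path_weight_Cons)
  qed auto
  obtain p where "is_path V E u p v" "graph_dist V E \<omega> u v = path_weight \<omega> p"
    using graph_dist_attained[OF assms(1,2,4,5)] by blast
  then show ?thesis
    using *[of p] by (auto simp: is_path_def)
qed

section \<open>Cyclic orders\<close>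

text \<open>Describing cyclic orders by their invariant sets, rather than by orbits, makes it easy to
  insert points, to delete points and to count crossings.\<close>

lemma cyclic_order_iff:
  "cyclic_order S \<sigma> \<longleftrightarrow> \<sigma> permutes S \<and> (\<forall>A\<subseteq>S. A \<noteq> {} \<longrightarrow> \<sigma> ` A \<subseteq> A \<longrightarrow> A = S)"
proof (intro iffI conjI allI impI)
  fix A assume *: "cyclic_order S \<sigma>" "A \<subseteq> S" "A \<noteq> {}" "\<sigma> ` A \<subseteq> A"
  then obtain x where x: "x \<in> A" by blast
  have "y \<in> A" if "y \<in> orbit \<sigma> x" for y
    using that by induction (use x *(4) in auto)
  with * x show "A = S" by (auto simp: cyclic_order_def)
next
  assume *: "\<sigma> permutes S \<and> (\<forall>A\<subseteq>S. A \<noteq> {} \<longrightarrow> \<sigma> ` A \<subseteq> A \<longrightarrow> A = S)"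
  have "orbit \<sigma> x = S" if x: "x \<in> S" for x
  proof -
    have "y \<in> S" if "y \<in> orbit \<sigma> x" for y
      using that by induction (use x * in \<open>auto simp: permutes_in_image\<close>)
    moreover have "\<sigma> ` orbit \<sigma> x \<subseteq> orbit \<sigma> x" "orbit \<sigma> x \<noteq> {}"
      by (auto intro: orbit.intros)
    ultimately show ?thesis using * by blast
  qed
  with * show "cyclic_order S \<sigma>" by (simp add: cyclic_order_def)
qed (simp add: cyclic_order_def)

lemma cyclic_order_leaves:
  assumes "cyclic_order S \<sigma>" "A \<subseteq> S" "A \<noteq> {}" "A \<noteq> S"
  obtains x where "x \<in> A" "\<sigma> x \<in> S - A"
proof -
  have "\<not> \<sigma> ` A \<subseteq> A"
    using assms unfolding cyclic_order_iff by blast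
  then obtain x where "x \<in> A" "\<sigma> x \<notin> A" by blast
  moreover have "\<sigma> x \<in> S"
    using \<open>x \<in> A\<close> assms(1,2) by (auto simp: cyclic_order_def permutes_in_image)
  ultimately show thesis using that by blast
qed

lemma cyclic_order_singleton: "cyclic_order {a} id"
  by (auto simp: cyclic_order_iff permutes_id)

text \<open>Composing a cyclic order with the transposition of \<open>a\<close> and \<open>b\<close> inserts a new point \<open>b\<close>
  right after \<open>a\<close>; if \<open>b\<close> already is the successor of \<open>a\<close>, the same operation deletes \<open>b\<close>.\<close>

lemma cyclic_order_insert:
  assumes "cyclic_order S \<sigma>" "a \<in> S" "b \<notin> S"
  shows "cyclic_order (insert b S) (\<sigma> \<circ> transpose a b)"
  unfolding cyclic_order_iff
proof (intro conjI allI impI)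
  have perm: "\<sigma> permutes S" using assms(1) by (simp add: cyclic_order_def)
  show "\<sigma> \<circ> transpose a b permutes insert b S"
    using assms(2) by (intro permutes_compose permutes_swap_id permutes_subset[OF perm]) auto
  fix A
  assume A: "A \<subseteq> insert b S" "A \<noteq> {}" "(\<sigma> \<circ> transpose a b) ` A \<subseteq> A"
  have b: "\<sigma> b = b" and in_S: "\<And>x. x \<in> S \<Longrightarrow> \<sigma> x \<in> S"
    using perm assms(3) by (auto simp: permutes_not_in permutes_in_image)
  have step: "\<sigma> (transpose a b x) \<in> A" if "x \<in> A" for x
    using A(3) that by auto
  have b_step: "\<sigma> a \<in> A" if "b \<in> A" using step[OF that] by simp
  have a_step: "b \<in> A" if "a \<in> A" using step[OF that] b by simp
  have "A - {b} \<noteq> {}"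
    using A(2) b_step in_S[OF assms(2)] assms(3) by blast
  moreover have "\<sigma> x \<in> A - {b}" if x: "x \<in> A - {b}" for x
  proof -
    have "\<sigma> x \<in> A"
      using step[of x] a_step b_step x by (cases "x = a") auto
    moreover have "\<sigma> x \<in> S" using x A(1) in_S by blast
    ultimately show ?thesis using assms(3) by auto
  qed
  moreover have "A - {b} \<subseteq> S" using A(1) by blast
  ultimately have "A - {b} = S"
    using assms(1) unfolding cyclic_order_iff by (metis image_subsetI)
  with a_step assms(2) show "A = insert b S" by blast
qed

lemma cyclic_order_delete:
  assumes "cyclic_order (insert b S) \<sigma>" "a \<in> S" "b \<notin> S" "\<sigma> a = b"
  shows "cyclic_order S (\<sigma> \<circ> transpose a b)"
  unfolding cyclic_order_iff
proof (intro conjI allI impI)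
  have perm: "\<sigma> permutes insert b S" using assms(1) by (simp add: cyclic_order_def)
  have "\<sigma> \<circ> transpose a b permutes insert b S"
    using assms(2) by (intro permutes_compose permutes_swap_id perm) auto
  then show "\<sigma> \<circ> transpose a b permutes S"
    by (rule permutes_superset) (use assms(4) in auto)
  fix A
  assume A: "A \<subseteq> S" "A \<noteq> {}" "(\<sigma> \<circ> transpose a b) ` A \<subseteq> A"
  have step: "\<sigma> (transpose a b x) \<in> A" if "x \<in> A" for x
    using A(3) that by auto
  have other: "\<sigma> x \<in> A" if "x \<in> A" "x \<noteq> a" for x
    using step[OF that(1)] that A(1) assms(3) by (metis subsetD transpose_apply_other)
  have min: "B = insert b S" if "B \<subseteq> insert b S" "B \<noteq> {}" "\<And>x. x \<in> B \<Longrightarrow> \<sigma> x \<in> B" for B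
    using assms(1) that unfolding cyclic_order_iff by (metis image_subsetI)
  have "a \<in> A"
  proof (rule ccontr)
    assume "a \<notin> A"
    with other A min[of A] have "A = insert b S" by blast
    with A(1) assms(3) show False by blast
  qed
  then have "\<sigma> b \<in> A" using step[of a] by simp
  then have "insert b A = insert b S"
    using other A(1) assms(4) by (intro min) auto
  moreover have "b \<notin> A" using A(1) assms(3) by blast
  ultimately show "A = S" using assms(3) by (simp add: insert_ident)
qed

text \<open>Under the triangle inequality, skipping points of a tour does not make it longer.\<close>

lemma cyclic_order_restrict:
  fixes d :: "'a \<Rightarrow> 'a \<Rightarrow> real"
  assumes "finite T" "cyclic_order T \<sigma>" "S \<subseteq> T"
    and nonneg: "\<And>x y. x \<in> T \<Longrightarrow> y \<in> T \<Longrightarrow> 0 \<le> d x y"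
    and triangle: "\<And>x y z. x \<in> T \<Longrightarrow> y \<in> T \<Longrightarrow> z \<in> T \<Longrightarrow> d x z \<le> d x y + d y z"
  shows "\<exists>\<tau>. cyclic_order S \<tau> \<and> (\<Sum>x\<in>S. d x (\<tau> x)) \<le> (\<Sum>x\<in>T. d x (\<sigma> x))"
  using assms
proof (induction T arbitrary: \<sigma> rule: finite_psubset_induct)
  case (psubset T)
  show ?case
  proof (cases "S = T")
    case False
    then obtain b where b: "b \<in> T" "b \<notin> S" using psubset.prems by blast
    define U where "U = T - {b}"
    have T: "T = insert b U" "b \<notin> U" "finite U" "U \<subset> T" "S \<subseteq> U"
      using b psubset.prems psubset.hyps by (auto simp: U_def)
    have perm: "\<sigma> permutes T" using psubset.prems(1) by (simp add: cyclic_order_def)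
    have in_T: "\<And>x. x \<in> T \<Longrightarrow> \<sigma> x \<in> T" using perm by (simp add: permutes_in_image)
    show ?thesis
    proof (cases "U = {}")
      case True
      have "cyclic_order {} id" by (auto simp: cyclic_order_iff permutes_id)
      moreover have "0 \<le> (\<Sum>x\<in>T. d x (\<sigma> x))"
        using psubset.prems in_T by (intro sum_nonneg) auto
      ultimately show ?thesis using True T by auto
    next
      case False
      have "U \<subseteq> T" "U \<noteq> T" using T by auto
      then obtain a where a: "a \<in> U" "\<sigma> a = b"
        using cyclic_order_leaves[OF psubset.prems(1) _ False] T(1) by blast
      define \<tau> where "\<tau> = \<sigma> \<circ> transpose a b"
      have \<tau>: "cyclic_order U \<tau>"
        unfolding \<tau>_def using psubset.prems(1) a T by (intro cyclic_order_delete) auto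
      have \<tau>_simps: "\<tau> a = \<sigma> b" "\<And>x. x \<in> U - {a} \<Longrightarrow> \<tau> x = \<sigma> x"
        using T(2) by (auto simp: \<tau>_def transpose_def)
      have "(\<Sum>x\<in>U. d x (\<tau> x)) = d a (\<sigma> b) + (\<Sum>x\<in>U - {a}. d x (\<sigma> x))"
        using T(3) a(1) \<tau>_simps by (simp add: sum.remove)
      also have "\<dots> \<le> d b (\<sigma> b) + (d a b + (\<Sum>x\<in>U - {a}. d x (\<sigma> x)))"
        using psubset.prems(4)[of a b "\<sigma> b"] a(1) T(1) in_T[of b] by simp
      also have "d a b + (\<Sum>x\<in>U - {a}. d x (\<sigma> x)) = (\<Sum>x\<in>U. d x (\<sigma> x))"
        using T(3) a by (simp add: sum.remove)
      also have "d b (\<sigma> b) + (\<Sum>x\<in>U. d x (\<sigma> x)) = (\<Sum>x\<in>T. d x (\<sigma> x))"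
        using T by simp
      finally have le: "(\<Sum>x\<in>U. d x (\<tau> x)) \<le> (\<Sum>x\<in>T. d x (\<sigma> x))" .
      have "\<exists>\<tau>'. cyclic_order S \<tau>' \<and> (\<Sum>x\<in>S. d x (\<tau>' x)) \<le> (\<Sum>x\<in>U. d x (\<tau> x))"
        using psubset.prems T(1) by (intro psubset.IH[OF T(4) \<tau> T(5)]) auto
      with le show ?thesis by (meson order_trans)
    qed
  qed (use psubset.prems in blast)
qed

text \<open>Cyclic orders on the image of \<open>M\<close> in the vertex type of a filling are pulled back to \<open>M\<close>.\<close>

lemma cyclic_order_vimage:
  assumes "cyclic_order (f ` S) \<sigma>" "inj f"
  obtains \<tau> where "cyclic_order S \<tau>" "\<And>x. x \<in> S \<Longrightarrow> f (\<tau> x) = \<sigma> (f x)"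
proof -
  define \<tau> where "\<tau> x = (if x \<in> S then inv f (\<sigma> (f x)) else x)" for x
  have perm: "\<sigma> permutes f ` S" using assms(1) by (simp add: cyclic_order_def)
  have f\<tau>: "\<tau> x \<in> S \<and> f (\<tau> x) = \<sigma> (f x)" if "x \<in> S" for x
  proof -
    have "\<sigma> (f x) \<in> f ` S" using perm that by (simp add: permutes_in_image)
    with that assms(2) show ?thesis by (auto simp: \<tau>_def)
  qed
  have "inj_on \<tau> S"
    by (rule inj_onI) (metis assms(2) f\<tau> injD perm permutes_inj)
  moreover have "y \<in> \<tau> ` S" if y: "y \<in> S" for y
  proof -
    have "f y \<in> \<sigma> ` f ` S" using permutes_image[OF perm] y by blast
    then show ?thesis using f\<tau> assms(2) by (auto dest: injD) (metis imageI injD)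
  qed
  ultimately have "\<tau> permutes S"
    using f\<tau> by (intro bij_imp_permutes) (auto simp: bij_betw_def \<tau>_def)
  moreover have "A = S" if A: "A \<subseteq> S" "A \<noteq> {}" "\<tau> ` A \<subseteq> A" for A
  proof -
    have "\<sigma> ` f ` A \<subseteq> f ` A"
    proof clarify
      fix x assume "x \<in> A"
      then show "\<sigma> (f x) \<in> f ` A" using f\<tau>[of x] A by (metis imageI subsetD)
    qed
    then have "f ` A = f ` S"
      using assms(1) A(1,2) unfolding cyclic_order_iff by (metis image_is_empty image_mono)
    then show ?thesis using assms(2) by (simp add: inj_image_eq_iff)
  qed
  ultimately have "cyclic_order S \<tau>" unfolding cyclic_order_iff by blast
  with f\<tau> that show thesis by blast
qed

section \<open>Every filling weighs at least the half-perimeter\<close>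

text \<open>A tour of all vertices that is at most twice as long as the graph is heavy. It grows along
  edges: \<open>F\<close> collects the edges already paid for, and an edge \<open>{a, b}\<close> leaving the set \<open>S\<close> of
  visited vertices pays for the detour from \<open>a\<close> to \<open>b\<close> and back.\<close>

lemma connected_graph_tour:
  assumes "finite_graph V E" "connected_graph V E" "weight_function E \<omega>"
  obtains \<sigma> where "cyclic_order V \<sigma>"
    "(\<Sum>x\<in>V. graph_dist V E \<omega> x (\<sigma> x)) \<le> 2 * graph_weight E \<omega>"
proof -
  let ?d = "graph_dist V E \<omega>"
  have fin: "finite V" using assms(1) by (simp add: finite_graph_def)
  have "E \<subseteq> Pow V" using assms(1) by (auto simp: finite_graph_def)
  then have finE: "finite E" using fin by (meson finite_Pow_iff finite_subset)
  have E_V: "x \<in> V \<and> y \<in> V" if "{x, y} \<in> E" for x y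
    using \<open>E \<subseteq> Pow V\<close> that by auto
  have tour: "\<exists>S \<sigma> F. S \<subseteq> V \<and> card S = Suc n \<and> cyclic_order S \<sigma> \<and> F \<subseteq> E \<and> F \<subseteq> Pow S \<and>
          (\<Sum>x\<in>S. ?d x (\<sigma> x)) \<le> 2 * sum \<omega> F" if "Suc n \<le> card V" for n
    using that
  proof (induction n)
    case 0
    obtain a where a: "a \<in> V" using assms(2) by (auto simp: connected_graph_def)
    show ?case
      using a cyclic_order_singleton[of a] graph_dist_self_le[OF fin a, of E \<omega>]
      by (intro exI[of _ "{a}"] exI[of _ id] exI[of _ "{}"]) (simp add: id_def)
  next
    case (Suc n)
    then obtain S \<sigma> F where S: "S \<subseteq> V" "card S = Suc n" "cyclic_order S \<sigma>"
      and F: "F \<subseteq> E" "F \<subseteq> Pow S" "(\<Sum>x\<in>S. ?d x (\<sigma> x)) \<le> 2 * sum \<omega> F"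
      by (metis Suc_leD)
    obtain s t where st: "s \<in> S" "t \<in> V" "t \<notin> S"
      using S(1,2) Suc.prems by (metis Suc_n_not_le_n card.empty ex_in_conv nat.simps(3)
          subset_antisym subset_iff)
    then obtain p where "is_path V E s p t"
      using assms(2) S(1) by (meson connected_graph_def subsetD)
    with st obtain a b where ab: "a \<in> S" "b \<notin> S" "{a, b} \<in> E"
      using successively_crossing[of "\<lambda>x y. {x, y} \<in> E" p S] by (auto simp: is_path_def)
    have finS: "finite S" using S(1) fin finite_subset by blast
    have finF: "finite F" using F(1) finE finite_subset by blast
    have V: "a \<in> V" "b \<in> V" "\<sigma> a \<in> V"
      using E_V[OF ab(3)] S(1,3) ab(1) by (auto simp: cyclic_order_def permutes_in_image)
    define \<tau> where "\<tau> = \<sigma> \<circ> transpose a b"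
    have "\<sigma> b = b" using S(3) ab(2) permutes_not_in cyclic_order_def by metis
    then have \<tau>_simps: "\<tau> b = \<sigma> a" "\<tau> a = b" "\<And>x. x \<in> S - {a} \<Longrightarrow> \<tau> x = \<sigma> x"
      using ab(2) by (auto simp: \<tau>_def transpose_def)
    have "(\<Sum>x\<in>insert b S. ?d x (\<tau> x)) = ?d b (\<sigma> a) + ?d a b + (\<Sum>x\<in>S - {a}. ?d x (\<sigma> x))"
      using finS ab \<tau>_simps by (simp add: sum.remove[of S a])
    also have "\<dots> \<le> 2 * \<omega> {a, b} + (?d a (\<sigma> a) + (\<Sum>x\<in>S - {a}. ?d x (\<sigma> x)))"
      using graph_dist_edge_triangle[OF fin assms(2,3), of b a "\<sigma> a"]
        graph_dist_edge_triangle[OF fin assms(2,3), of a b b]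
        graph_dist_self_le[OF fin V(2), of E \<omega>] V ab(3)
      by (simp add: insert_commute)
    also have "?d a (\<sigma> a) + (\<Sum>x\<in>S - {a}. ?d x (\<sigma> x)) = (\<Sum>x\<in>S. ?d x (\<sigma> x))"
      using finS ab(1) by (simp add: sum.remove[of S a])
    also have "2 * \<omega> {a, b} + (\<Sum>x\<in>S. ?d x (\<sigma> x)) \<le> 2 * sum \<omega> (insert {a, b} F)"
    proof -
      have "{a, b} \<notin> F" using F(2) ab(2) by blast
      with F(3) finF show ?thesis by simp
    qed
    finally have "(\<Sum>x\<in>insert b S. ?d x (\<tau> x)) \<le> 2 * sum \<omega> (insert {a, b} F)" .
    moreover have "cyclic_order (insert b S) \<tau>"
      unfolding \<tau>_def using S(3) ab(1,2) by (rule cyclic_order_insert)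
    moreover have "card (insert b S) = Suc (Suc n)" using finS ab(2) S(2) by simp
    moreover have "insert b S \<subseteq> V" "insert {a, b} F \<subseteq> E" "insert {a, b} F \<subseteq> Pow (insert b S)"
      using V S(1) F ab by auto
    ultimately show ?case
      by (intro exI[of _ "insert b S"] exI[of _ \<tau>] exI[of _ "insert {a, b} F"]) simp
  qed
  have "Suc (card V - 1) = card V"
    using assms(2) fin by (simp add: connected_graph_def card_gt_0_iff)
  with tour[of "card V - 1"] obtain S \<sigma> F where S: "S \<subseteq> V" "card S = card V" "cyclic_order S \<sigma>"
    and F: "F \<subseteq> E" "(\<Sum>x\<in>S. ?d x (\<sigma> x)) \<le> 2 * sum \<omega> F" by auto
  have "S = V" using S(1,2) fin by (simp add: card_subset_eq)
  moreover have "sum \<omega> F \<le> graph_weight E \<omega>"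
    unfolding graph_weight_def
    using finE F(1) assms(3) by (intro sum_mono2) (auto simp: weight_function_def)
  ultimately show thesis using that S(3) F(2) by auto
qed

lemma half_perimeter_eq_Min:
  "half_perimeter M \<rho> = Min ((\<lambda>\<sigma>. 1/2 * (\<Sum>x\<in>M. \<rho> x (\<sigma> x))) ` {\<sigma>. cyclic_order M \<sigma>})"
  unfolding half_perimeter_def by (rule arg_cong[where f = Min]) blast

lemma finite_cyclic_orders:
  assumes "finite M"
  shows "finite {\<sigma>. cyclic_order M \<sigma>}"
  using finite_permutations[OF assms] by (rule rev_finite_subset) (auto simp: cyclic_order_def)

lemma half_perimeter_le:
  assumes "finite M" "cyclic_order M \<sigma>"
  shows "half_perimeter M \<rho> \<le> 1/2 * (\<Sum>x\<in>M. \<rho> x (\<sigma> x))"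
  unfolding half_perimeter_eq_Min
  using assms finite_cyclic_orders by (intro Min_le finite_imageI imageI) auto

lemma half_perimeter_attained:
  assumes "finite M" "cyclic_order M \<sigma>"
  obtains \<tau> where "cyclic_order M \<tau>" "half_perimeter M \<rho> = 1/2 * (\<Sum>x\<in>M. \<rho> x (\<tau> x))"
proof -
  have "half_perimeter M \<rho> \<in> (\<lambda>\<sigma>. 1/2 * (\<Sum>x\<in>M. \<rho> x (\<sigma> x))) ` {\<sigma>. cyclic_order M \<sigma>}"
    unfolding half_perimeter_eq_Min
    using assms finite_cyclic_orders by (intro Min_in finite_imageI) auto
  with that show thesis by auto
qed

lemma filling_tour:
  assumes "filling M \<rho> V E \<omega>"
  obtains \<sigma> where "cyclic_order M \<sigma>" "1/2 * (\<Sum>x\<in>M. \<rho> x (\<sigma> x)) \<le> graph_weight E \<omega>"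
proof -
  let ?d = "graph_dist V E \<omega>"
  have G: "finite_graph V E" "connected_graph V E" "weight_function E \<omega>" "Inl ` M \<subseteq> V"
    and dom: "\<And>p q. p \<in> M \<Longrightarrow> q \<in> M \<Longrightarrow> \<rho> p q \<le> ?d (Inl p) (Inl q)"
    using assms by (auto simp: filling_def joins_def)
  have fin: "finite V" using G(1) by (simp add: finite_graph_def)
  obtain \<sigma> where \<sigma>: "cyclic_order V \<sigma>" "(\<Sum>x\<in>V. ?d x (\<sigma> x)) \<le> 2 * graph_weight E \<omega>"
    using connected_graph_tour[OF G(1-3)] .
  obtain \<tau>' where \<tau>': "cyclic_order (Inl ` M) \<tau>'"
      "(\<Sum>x\<in>Inl ` M. ?d x (\<tau>' x)) \<le> (\<Sum>x\<in>V. ?d x (\<sigma> x))"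
    using cyclic_order_restrict[OF fin \<sigma>(1) G(4), of ?d]
      graph_dist_nonneg[OF fin G(2,3)] graph_dist_triangle[OF fin G(2,3)] by blast
  obtain \<tau> where \<tau>: "cyclic_order M \<tau>" "\<And>x. x \<in> M \<Longrightarrow> Inl (\<tau> x) = \<tau>' (Inl x)"
    using cyclic_order_vimage[OF \<tau>'(1)] by auto
  have "(\<Sum>x\<in>M. \<rho> x (\<tau> x)) \<le> (\<Sum>x\<in>M. ?d (Inl x) (Inl (\<tau> x)))"
    using \<tau>(1) by (intro sum_mono dom) (auto simp: cyclic_order_def permutes_in_image)
  also have "\<dots> = (\<Sum>x\<in>Inl ` M. ?d x (\<tau>' x))"
    using \<tau>(2) by (simp add: sum.reindex)
  finally show thesis using that[OF \<tau>(1)] \<tau>'(2) \<sigma>(2) by simp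
qed

section \<open>An additive space has a filling as light as its half-perimeter\<close>

lemma successively_avoiding:
  assumes "successively (\<lambda>x y. {x, y} \<in> E) p" "z \<in> e" "z \<notin> set p"
  shows "successively (\<lambda>x y. {x, y} \<in> E - {e}) p"
  using assms(1) by (rule successively_mono) (use assms(2,3) in auto)

text \<open>In a tree, removing an edge of a path separates the end points of that path. The set \<open>C\<close> is a
  component of the remaining graph; the last condition says that \<open>e\<close> is the only edge leaving it.\<close>

lemma tree_edge_separates:
  assumes "is_tree V E" "is_path V E p P q" "e \<in> path_edges P"
  obtains C where "p \<in> C" "q \<notin> C"
    "\<And>x y. {x, y} \<in> E \<Longrightarrow> x \<in> C \<Longrightarrow> y \<notin> C \<Longrightarrow> {x, y} = e"
proof -
  define R where "R = {(x, y). {x, y} \<in> E - {e}}"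
  obtain xs a b ys where P: "P = xs @ a # b # ys" and e: "e = {a, b}"
    using path_edges_split[OF assms(3)] .
  have distinct: "distinct P" and succ: "successively (\<lambda>x y. {x, y} \<in> E) P"
    and ends: "hd P = p" "last P = q" and PV: "set P \<subseteq> V"
    using assms(2) by (auto simp: is_path_def)
  have "sym R" by (auto simp: sym_def R_def insert_commute)
  then have symR: "sym (R\<^sup>*)" by (rule sym_rtrancl)
  have "(p, a) \<in> R\<^sup>*"
  proof -
    have "successively (\<lambda>x y. {x, y} \<in> E - {e}) (xs @ [a])"
      by (rule successively_avoiding[of _ _ b])
        (use succ distinct in \<open>auto simp: P e successively_append_iff\<close>)
    from successively_rtrancl[OF this] show ?thesis
      using ends(1) by (cases xs) (auto simp: P R_def)
  qed
  then have ap: "(a, p) \<in> R\<^sup>*" using symR by (meson symD)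
  have bq: "(b, q) \<in> R\<^sup>*"
  proof -
    have "successively (\<lambda>x y. {x, y} \<in> E - {e}) (b # ys)"
      by (rule successively_avoiding[of _ _ a])
        (use succ distinct in \<open>auto simp: P e successively_append_iff\<close>)
    from successively_rtrancl[OF this] show ?thesis
      using ends(2) by (auto simp: P R_def)
  qed
  have "(b, a) \<notin> R\<^sup>*"
  proof
    assume "(b, a) \<in> R\<^sup>*"
    moreover have "x \<in> V" if "{x, y} \<in> E - {e}" for x y
      using assms(1) that by (auto simp: is_tree_def finite_graph_def doubleton_eq_iff)
    ultimately obtain c where c: "is_path V (E - {e}) b c a"
      using rtrancl_imp_is_path[of b a "E - {e}" V] PV by (auto simp: R_def P)
    have "a \<noteq> b" using distinct by (auto simp: P)
    \<comment> \<open>a path of only two vertices would be the removed edge itself\<close>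
    have "length c \<ge> 3"
    proof (rule ccontr)
      assume "\<not> 3 \<le> length c"
      then have "length c = 0 \<or> length c = 1 \<or> length c = 2" by linarith
      with c \<open>a \<noteq> b\<close> show False
        by (auto simp: is_path_def e length_Suc_conv numeral_2_eq_2 insert_commute)
    qed
    moreover have "{last c, hd c} \<in> E"
      using c succ by (auto simp: is_path_def P successively_append_iff)
    moreover have "successively (\<lambda>x y. {x, y} \<in> E) c"
      using c by (auto simp: is_path_def intro: successively_mono)
    ultimately have "is_cycle V E c" using c by (auto simp: is_cycle_def is_path_def)
    with assms(1) show False by (auto simp: is_tree_def)
  qed
  moreover have "(b, a) \<in> R\<^sup>*" if "(a, q) \<in> R\<^sup>*"
    using bq that symR by (meson rtrancl_trans symD)
  moreover have "{x, y} = e" if "{x, y} \<in> E" "(a, x) \<in> R\<^sup>*" "(a, y) \<notin> R\<^sup>*" for x y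
  proof (rule ccontr)
    assume "{x, y} \<noteq> e"
    with that(1) have "(x, y) \<in> R" by (simp add: R_def)
    with that(2,3) show False by (meson rtrancl.rtrancl_into_rtrancl)
  qed
  ultimately show thesis
    using that[of "{x. (a, x) \<in> R\<^sup>*}"] ap by auto
qed

text \<open>Edges that lie on no path between points of \<open>M\<close> get weight \<open>0\<close>. This does not change any
  distance within \<open>M\<close>, and every edge that keeps its weight separates two points of \<open>M\<close>, so a
  cyclic order on \<open>M\<close> crosses it in both directions.\<close>

lemma additive_filling:
  assumes "finite M" "additive_space M \<rho>"
  obtains V E \<omega> where "filling M \<rho> V E \<omega>"
    "\<And>\<sigma>. cyclic_order M \<sigma> \<Longrightarrow> graph_weight E \<omega> \<le> 1/2 * (\<Sum>x\<in>M. \<rho> x (\<sigma> x))"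
proof -
  obtain V :: "('a + nat) set" and E \<omega> where tree: "is_tree V E" and joins: "joins V E (Inl ` M)"
    and w: "weight_function E \<omega>"
    and dist: "\<And>p q. p \<in> M \<Longrightarrow> q \<in> M \<Longrightarrow> \<rho> p q = graph_dist V E \<omega> (Inl p) (Inl q)"
    using assms(2) unfolding additive_space_def by blast
  have fin: "finite V" and conn: "connected_graph V E" and MV: "\<And>x. x \<in> M \<Longrightarrow> Inl x \<in> V"
    using joins by (auto simp: joins_def finite_graph_def)
  have "E \<subseteq> Pow V" using joins by (auto simp: joins_def finite_graph_def)
  then have finE: "finite E" using fin by (meson finite_Pow_iff finite_subset)
  define U where
    "U = {e \<in> E. \<exists>p\<in>M. \<exists>q\<in>M. \<exists>P. is_path V E (Inl p) P (Inl q) \<and> e \<in> path_edges P}"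
  define \<omega>' where "\<omega>' e = (if e \<in> U then \<omega> e else 0)" for e
  have w': "weight_function E \<omega>'" using w by (auto simp: weight_function_def \<omega>'_def)
  have "filling M \<rho> V E \<omega>'"
    unfolding filling_def
  proof (intro conjI ballI)
    fix p q assume pq: "p \<in> M" "q \<in> M"
    obtain P where P: "is_path V E (Inl p) P (Inl q)"
        "graph_dist V E \<omega>' (Inl p) (Inl q) = path_weight \<omega>' P"
      using graph_dist_attained[OF fin conn MV[OF pq(1)] MV[OF pq(2)]] by blast
    have "path_edges P \<subseteq> E"
      using P(1) path_edges_subset by (auto simp: is_path_def)
    then have "path_edges P \<subseteq> U" using P(1) pq by (auto simp: U_def)
    then have "path_weight \<omega>' P = path_weight \<omega> P"
      unfolding path_weight_def by (intro sum.cong) (auto simp: \<omega>'_def path_edges_def)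
    then show "\<rho> p q \<le> graph_dist V E \<omega>' (Inl p) (Inl q)"
      using dist[OF pq] graph_dist_le[OF fin P(1)] P(2) by metis
  qed (use joins w' in auto)
  moreover have "graph_weight E \<omega>' \<le> 1/2 * (\<Sum>x\<in>M. \<rho> x (\<sigma> x))" if \<sigma>: "cyclic_order M \<sigma>" for \<sigma>
  proof -
    have \<sigma>M: "\<And>x. x \<in> M \<Longrightarrow> \<sigma> x \<in> M" using \<sigma> by (simp add: cyclic_order_def permutes_in_image)
    have "\<exists>P. is_path V E (Inl x) P (Inl (\<sigma> x)) \<and> path_weight \<omega> P = \<rho> x (\<sigma> x)"
      if "x \<in> M" for x
      using that \<sigma>M dist[OF that] graph_dist_attained[OF fin conn MV MV] by metis
    then obtain P where P: "\<And>x. x \<in> M \<Longrightarrow> is_path V E (Inl x) (P x) (Inl (\<sigma> x))"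
        "\<And>x. x \<in> M \<Longrightarrow> path_weight \<omega> (P x) = \<rho> x (\<sigma> x)"
      by metis
    have sub: "path_edges (P x) \<subseteq> E" if "x \<in> M" for x
      using P(1)[OF that] path_edges_subset by (auto simp: is_path_def)
    have twice: "2 \<le> card {x \<in> M. e \<in> path_edges (P x)}" if e: "e \<in> U" for e
    proof -
      obtain p q Q where pq: "p \<in> M" "q \<in> M" "is_path V E (Inl p) Q (Inl q)" "e \<in> path_edges Q"
        using e by (auto simp: U_def)
      obtain C where C: "Inl p \<in> C" "Inl q \<notin> C"
        "\<And>x y. {x, y} \<in> E \<Longrightarrow> x \<in> C \<Longrightarrow> y \<notin> C \<Longrightarrow> {x, y} = e"
        using tree_edge_separates[OF tree pq(3,4)] by blast
      have cross: "e \<in> path_edges (P x)"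
        if x: "x \<in> M" and D: "D = C \<or> D = - C" "Inl x \<in> D" "Inl (\<sigma> x) \<notin> D" for x D
      proof -
        obtain y z where yz: "y \<in> D" "z \<notin> D" "{y, z} \<in> path_edges (P x)"
          by (rule successively_crossing[OF successively_path_edges, of "P x" D])
            (use P(1)[OF x] D in \<open>auto simp: is_path_def\<close>)
        have "{y, z} \<in> E" "{z, y} \<in> E" using yz(3) sub[OF x] by (auto simp: insert_commute)
        then have "{y, z} = e"
          using D(1) yz(1,2) C(3)[of y z] C(3)[of z y] by (auto simp: insert_commute)
        with yz(3) show ?thesis by simp
      qed
      let ?A = "{x \<in> M. Inl x \<in> C}"
      obtain x where x: "x \<in> ?A" "\<sigma> x \<in> M - ?A"
        by (rule cyclic_order_leaves[OF \<sigma>, of ?A]) (use pq C in auto)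
      obtain y where y: "y \<in> M - ?A" "\<sigma> y \<in> M - (M - ?A)"
        by (rule cyclic_order_leaves[OF \<sigma>, of "M - ?A"]) (use pq C in auto)
      have "{x, y} \<subseteq> {x \<in> M. e \<in> path_edges (P x)}"
        using x y cross[of x C] cross[of y "- C"] by auto
      moreover have "x \<noteq> y" using x y by auto
      ultimately show ?thesis
        using card_mono[of "{x \<in> M. e \<in> path_edges (P x)}" "{x, y}"] assms(1) by simp
    qed
    have "2 * graph_weight E \<omega>' = (\<Sum>e\<in>E. 2 * \<omega>' e)"
      by (simp add: graph_weight_def sum_distrib_left)
    also have "\<dots> \<le> (\<Sum>e\<in>E. real (card {x \<in> M. e \<in> path_edges (P x)}) * \<omega> e)"
    proof (rule sum_mono)
      fix e assume "e \<in> E"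
      then have "0 \<le> \<omega> e" using w by (simp add: weight_function_def)
      then show "2 * \<omega>' e \<le> real (card {x \<in> M. e \<in> path_edges (P x)}) * \<omega> e"
        using twice[of e] by (auto simp: \<omega>'_def intro: mult_right_mono)
    qed
    \<comment> \<open>double counting of the pairs of a point and an edge used on the way to its successor\<close>
    also have "\<dots> = (\<Sum>e\<in>E. \<Sum>x | x \<in> M \<and> e \<in> path_edges (P x). \<omega> e)"
      by simp
    also have "\<dots> = (\<Sum>x\<in>M. \<Sum>e | e \<in> E \<and> e \<in> path_edges (P x). \<omega> e)"
      using finE assms(1) by (rule sum.swap_restrict)
    also have "\<dots> = (\<Sum>x\<in>M. sum \<omega> (path_edges (P x)))"
      using sub by (intro sum.cong refl) blast
    also have "\<dots> \<le> (\<Sum>x\<in>M. \<rho> x (\<sigma> x))"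
    proof (rule sum_mono)
      fix x assume x: "x \<in> M"
      show "sum \<omega> (path_edges (P x)) \<le> \<rho> x (\<sigma> x)"
        using sum_path_edges_le[OF w, of "P x"] P[OF x] by (auto simp: is_path_def)
    qed
    finally show ?thesis by simp
  qed
  ultimately show thesis by (rule that)
qed

theorem corollary9p5:
  fixes M :: "'a set" and \<rho> :: "'a \<Rightarrow> 'a \<Rightarrow> real"
  assumes "finite M"
    and "pseudo_metric_on M \<rho>"
    and "additive_space M \<rho>"
  shows "mf M \<rho> = half_perimeter M \<rho>"
proof (rule antisym)
  obtain V E \<omega> where F: "filling M \<rho> V E \<omega>"
    and light: "\<And>\<sigma>. cyclic_order M \<sigma> \<Longrightarrow> graph_weight E \<omega> \<le> 1/2 * (\<Sum>x\<in>M. \<rho> x (\<sigma> x))"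
    using additive_filling[OF assms(1,3)] by blast
  obtain \<sigma> where \<sigma>: "cyclic_order M \<sigma>" "half_perimeter M \<rho> = 1/2 * (\<Sum>x\<in>M. \<rho> x (\<sigma> x))"
    using filling_tour[OF F] half_perimeter_attained[OF assms(1)] by metis
  have lower: "half_perimeter M \<rho> \<le> w"
    if w: "w \<in> {graph_weight E \<omega> | V E \<omega>. filling M \<rho> V E \<omega>}" for w
  proof -
    obtain V' E' \<omega>' where "filling M \<rho> V' E' \<omega>'" "w = graph_weight E' \<omega>'"
      using w by blast
    then obtain \<tau> where "cyclic_order M \<tau>" "1/2 * (\<Sum>x\<in>M. \<rho> x (\<tau> x)) \<le> w"
      using filling_tour by metis
    then show ?thesis using half_perimeter_le[OF assms(1), of \<tau> \<rho>] by linarith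
  qed
  show "half_perimeter M \<rho> \<le> mf M \<rho>"
    unfolding mf_def using F lower by (intro cInf_greatest) auto
  have "mf M \<rho> \<le> graph_weight E \<omega>"
    unfolding mf_def using F lower by (intro cInf_lower bdd_belowI) auto
  with light[OF \<sigma>(1)] \<sigma>(2) show "mf M \<rho> \<le> half_perimeter M \<rho>" by simp
qed

end
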